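(* Let $\Phi \equiv \exists x_m \cdots \exists x_1.\ \bigwedge_i \varphi_i(x_1,\dots,x_n)$ (with $m\le n$) be a linear real arithmetic formula, where each $\varphi_i$ is an atomic formula $a_{i,1}x_1+\dots+a_{i,n}x_n-b_i\bowtie 0$ with real constants and $\bowtie\in\{<,>,=,\le,\ge\}$. Let $T=(\mathcal{B},E_T)$ be any nice tree decomposition of the primal graph $G_\Phi$ of $\Phi$, with root $r_T$, and let $\mathcal{I}$ and $\mathcal{V}$ be the functions computed by the dynamic programming procedure described below. Then the quantifier-free formula $\bigwedge \mathcal{V}(r_T)$ (in the free variables $x_{m+1},\dots,x_n$) is equivalent to $\Phi$ over $\mathbb{R}$.
   Context: Primal graph: $G_\Phi=(V_\Phi,E_\Phi)$ has vertex set $\{x_1,\dots,x_m\}$ (the quantified variables), and $x_j,x_{j'}$ are adjacent iff both occur (with nonzero coefficient) in some common atomic formula of $\Phi$. For an atomic formula $\varphi$, $\mathrm{var}(\varphi)$ denotes the set of quantified variables occurring in it. Tree decomposition of a graph $G=(V,E)$: a tree $T$ whose nodes (bags) $b$ are labelled by subsets $V_b\subseteq V$ such that $\bigcup_b V_b=V$, every edge of $G$ has both endpoints in some bag, and for every vertex $v$ the bags containing $v$ form a connected subtree. It is nice if it is rooted at a bag $r$ with $V_r=\emptyset$ and every bag is one of: a leaf bag (no children, $|V_b|=1$); a join bag (exactly two children $b_1,b_2$ with $V_b=V_{b_1}=V_{b_2}$); an introduce bag (one child $b'$, $V_{b'}\subseteq V_b$, $|V_b|=|V_{b'}|+1$);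 a forget bag (one child $b'$, $V_b\subseteq V_{b'}$, $|V_b|=|V_{b'}|-1$; the variable in $V_{b'}\setminus V_b$ is denoted $b.\mathrm{forget}$). Fourier–Motzkin elimination: for a set $C$ of linear atomic formulas and a variable $x$, $\mathrm{FME}(C,x)$ is defined as follows. (I) If $x$ occurs with nonzero coefficient in some equality of $C$, remove that equality, solve it for $x$, and substitute the resulting linear term for $x$ in all remaining formulas. (II) Otherwise, keep all formulas of $C$ not containing $x$; rewrite each inequality containing $x$ as either $x\lhd u$ (an upper bound $u$) or $l\lhd x$ (a lower bound $l$), with $\lhd\in\{<,\le\}$; and add, for every pair of a lower bound $l$ and an upper bound $u$, the formula $l<u$ if both bounds are strict and $l\le u$ otherwise. The result contains no $x$ and $\exists x.\bigwedge C\equiv\bigwedge\mathrm{FME}(C,x)$. Dynamic programming procedure: Let $C$ be the set of atomic formulas of $\Phi$. Traverse the bags of $T$ top-down in breadth-first order starting at $r_T$; when visiting a bag $b$: if $b$ is a leaf bag set $\mathcal{I}(b)=\emptyset$; otherwise set $\mathcal{I}(b)=\{\varphi\in C:\mathrm{var}(\varphi)\subseteq V_b\}$ and remove these formulas from $C$. Then compute $\mathcal{V}$ bottom-up (children before parents): $\mathcal{V}(b)=\mathcal{I}(b)\cup\mathcal{V}(b_1)\cup\mathcal{V}(b_2)$ for a join bag with children $b_1,b_2$; $\mathcal{V}(b)=\mathcal{I}(b)\cup\mathcal{V}(b')$ for an introduce bag with child $b'$; $\mathcal{V}(b)=\mathcal{I}(b)\cup\mathrm{FME}(\mathcal{V}(b'),b.\mathrm{forget})$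 for a forget bag with child $b'$; $\mathcal{V}(b)=\mathcal{I}(b)$ for a leaf bag.
   Formalization: Two corrections: in Fourier–Motzkin the combined formula is l<u if at least one bound is strict (l≤u only if both are non-strict); and every atomic formula's quantified variables are assumed to lie in some non-leaf bag, since otherwise the procedure drops that formula. *)

theory Defs
  imports Complex_Main
begin

section \<open>Linear real arithmetic\<close>

text \<open>
  \<open>Lin a b\<close> stands for \<open>a 1 * x\<^sub>1 + \<dots> + a n * x\<^sub>n - b\<close>. The number \<open>n\<close> of variables is a
  parameter of the semantics; coefficients with an index outside \<open>{1..n}\<close> are ignored.
\<close>

datatype linexp = Lin (coeff: "nat \<Rightarrow> real") (offset: real)

datatype comparison = Lt | Gt | Eq | Le | Ge

datatype atom = Atom (lin: linexp) (cmp: comparison)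

definition lin_val :: "nat \<Rightarrow> linexp \<Rightarrow> (nat \<Rightarrow> real) \<Rightarrow> real" where
  "lin_val n e \<sigma> = (\<Sum>i\<in>{1..n}. coeff e i * \<sigma> i) - offset e"

fun compare_zero :: "comparison \<Rightarrow> real \<Rightarrow> bool" where
  "compare_zero Lt t \<longleftrightarrow> t < 0"
| "compare_zero Gt t \<longleftrightarrow> t > 0"
| "compare_zero Eq t \<longleftrightarrow> t = 0"
| "compare_zero Le t \<longleftrightarrow> t \<le> 0"
| "compare_zero Ge t \<longleftrightarrow> t \<ge> 0"

definition holds :: "nat \<Rightarrow> (nat \<Rightarrow> real) \<Rightarrow> atom \<Rightarrow> bool" where
  "holds n \<sigma> \<phi> \<longleftrightarrow> compare_zero (cmp \<phi>) (lin_val n (lin \<phi>) \<sigma>)"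

definition occurs :: "nat \<Rightarrow> atom \<Rightarrow> bool" where
  "occurs x \<phi> \<longleftrightarrow> coeff (lin \<phi>) x \<noteq> 0"

text \<open>Only the quantified variables \<open>x\<^sub>1, \<dots>, x\<^sub>m\<close> are collected.\<close>

definition vars :: "nat \<Rightarrow> atom \<Rightarrow> nat set" where
  "vars m \<phi> = {x \<in> {1..m}. occurs x \<phi>}"

text \<open>\<open>exists_block m P \<sigma>\<close> is \<open>\<exists>x\<^sub>m. \<dots> \<exists>x\<^sub>1. P\<close> under the assignment \<open>\<sigma>\<close>.\<close>

fun exists_block :: "nat \<Rightarrow> ((nat \<Rightarrow> real) \<Rightarrow> bool) \<Rightarrow> (nat \<Rightarrow> real) \<Rightarrow> bool" where
  "exists_block 0 P \<sigma> \<longleftrightarrow> P \<sigma>"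
| "exists_block (Suc k) P \<sigma> \<longleftrightarrow> (\<exists>v. exists_block k P (\<sigma>(Suc k := v)))"


section \<open>Fourier--Motzkin elimination\<close>

text \<open>
  For an expression \<open>e\<close> containing \<open>x\<close>, the term \<open>isolate x e\<close> does not contain \<open>x\<close> and
  \<open>e = 0\<close> is equivalent to \<open>x = isolate x e\<close>.
\<close>

definition isolate :: "nat \<Rightarrow> linexp \<Rightarrow> linexp" where
  "isolate x e =
     Lin (\<lambda>i. if i = x then 0 else - coeff e i / coeff e x) (- offset e / coeff e x)"

definition subst_lin :: "nat \<Rightarrow> linexp \<Rightarrow> linexp \<Rightarrow> linexp" where
  "subst_lin x u e =
     Lin (\<lambda>i. (if i = x then 0 else coeff e i) + coeff e x * coeff u i)
         (offset e + coeff e x * offset u)"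

definition subst_atom :: "nat \<Rightarrow> linexp \<Rightarrow> atom \<Rightarrow> atom" where
  "subst_atom x u \<phi> = Atom (subst_lin x u (lin \<phi>)) (cmp \<phi>)"

definition lin_diff :: "linexp \<Rightarrow> linexp \<Rightarrow> linexp" where
  "lin_diff e f = Lin (\<lambda>i. coeff e i - coeff f i) (offset e - offset f)"

text \<open>
  A bound is paired with a flag telling whether it is strict. Dividing by a negative
  coefficient of \<open>x\<close> turns the comparison around.
\<close>

definition strict :: "atom \<Rightarrow> bool" where
  "strict \<phi> \<longleftrightarrow> cmp \<phi> \<in> {Lt, Gt}"

definition upper_bounds :: "atom set \<Rightarrow> nat \<Rightarrow> (linexp \<times> bool) set" where
  "upper_bounds C x = {(isolate x (lin \<phi>), strict \<phi>) | \<phi>. \<phi> \<in> C \<and>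
     (coeff (lin \<phi>) x > 0 \<and> cmp \<phi> \<in> {Lt, Le} \<or> coeff (lin \<phi>) x < 0 \<and> cmp \<phi> \<in> {Gt, Ge})}"

definition lower_bounds :: "atom set \<Rightarrow> nat \<Rightarrow> (linexp \<times> bool) set" where
  "lower_bounds C x = {(isolate x (lin \<phi>), strict \<phi>) | \<phi>. \<phi> \<in> C \<and>
     (coeff (lin \<phi>) x > 0 \<and> cmp \<phi> \<in> {Gt, Ge} \<or> coeff (lin \<phi>) x < 0 \<and> cmp \<phi> \<in> {Lt, Le})}"

text \<open>
  The combination of a lower and an upper bound is non-strict only if both bounds are
  non-strict. Making it strict only when both are strict would turn the unsatisfiable
  \<open>0 < x \<and> x \<le> 0\<close> into \<open>0 \<le> 0\<close>.
\<close>

definition combine_bounds :: "linexp \<times> bool \<Rightarrow> linexp \<times> bool \<Rightarrow> atom" where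
  "combine_bounds l u = Atom (lin_diff (fst l) (fst u)) (if snd l \<or> snd u then Lt else Le)"

text \<open>
  A relation, because the equality used for the substitution may be chosen freely.
\<close>

definition FME :: "atom set \<Rightarrow> nat \<Rightarrow> atom set \<Rightarrow> bool" where
  "FME C x D \<longleftrightarrow>
     (if \<exists>\<phi>\<in>C. cmp \<phi> = Eq \<and> occurs x \<phi>
      then \<exists>\<phi>\<in>C. cmp \<phi> = Eq \<and> occurs x \<phi> \<and>
             D = subst_atom x (isolate x (lin \<phi>)) ` (C - {\<phi>})
      else D = {\<phi> \<in> C. \<not> occurs x \<phi>} \<union>
             {combine_bounds l u | l u. l \<in> lower_bounds C x \<and> u \<in> upper_bounds C x})"


section \<open>Primal graph and nice tree decompositions\<close>

text \<open>The vertex set of the primal graph is \<open>{1..m}\<close>; edges are two-element sets.\<close>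

definition primal_edges :: "nat \<Rightarrow> atom set \<Rightarrow> nat set set" where
  "primal_edges m C =
     {{i, j} | i j. i \<noteq> j \<and> (\<exists>\<phi>\<in>C. i \<in> vars m \<phi> \<and> j \<in> vars m \<phi>)}"

text \<open>
  A finite rooted tree is given by its nodes, its root and its edges oriented away from the
  root: \<open>(b, c) \<in> E\<close> means that \<open>c\<close> is a child of \<open>b\<close>.
\<close>

definition rooted_tree :: "'b set \<Rightarrow> ('b \<times> 'b) set \<Rightarrow> 'b \<Rightarrow> bool" where
  "rooted_tree B E r \<longleftrightarrow>
     finite B \<and> r \<in> B \<and> E \<subseteq> B \<times> B \<and>
     (\<forall>b. (b, r) \<notin> E) \<and>
     (\<forall>b c d. (b, d) \<in> E \<longrightarrow> (c, d) \<in> E \<longrightarrow> b = c) \<and>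
     (\<forall>b\<in>B. (r, b) \<in> E\<^sup>*)"

definition tree_decomposition ::
    "nat set \<Rightarrow> nat set set \<Rightarrow> 'b set \<Rightarrow> ('b \<times> 'b) set \<Rightarrow> 'b \<Rightarrow> ('b \<Rightarrow> nat set) \<Rightarrow> bool" where
  "tree_decomposition V G B E r bag \<longleftrightarrow>
     rooted_tree B E r \<and>
     (\<Union>b\<in>B. bag b) = V \<and>
     (\<forall>e\<in>G. \<exists>b\<in>B. e \<subseteq> bag b) \<and>
     (\<forall>v\<in>V. let S = {b \<in> B. v \<in> bag b} in
        \<forall>b\<in>S. \<forall>c\<in>S. (b, c) \<in> ((E \<union> E\<inverse>) \<inter> S \<times> S)\<^sup>*)"

definition leaf_bag :: "('b \<times> 'b) set \<Rightarrow> ('b \<Rightarrow> nat set) \<Rightarrow> 'b \<Rightarrow> bool" where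
  "leaf_bag E bag b \<longleftrightarrow> E `` {b} = {} \<and> card (bag b) = 1"

definition join_bag :: "('b \<times> 'b) set \<Rightarrow> ('b \<Rightarrow> nat set) \<Rightarrow> 'b \<Rightarrow> 'b \<Rightarrow> 'b \<Rightarrow> bool" where
  "join_bag E bag b b1 b2 \<longleftrightarrow>
     E `` {b} = {b1, b2} \<and> b1 \<noteq> b2 \<and> bag b = bag b1 \<and> bag b = bag b2"

definition introduce_bag :: "('b \<times> 'b) set \<Rightarrow> ('b \<Rightarrow> nat set) \<Rightarrow> 'b \<Rightarrow> 'b \<Rightarrow> bool" where
  "introduce_bag E bag b b' \<longleftrightarrow>
     E `` {b} = {b'} \<and> bag b' \<subseteq> bag b \<and> card (bag b) = card (bag b') + 1"

definition forget_bag :: "('b \<times> 'b) set \<Rightarrow> ('b \<Rightarrow> nat set) \<Rightarrow> 'b \<Rightarrow> 'b \<Rightarrow> bool" where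
  "forget_bag E bag b b' \<longleftrightarrow>
     E `` {b} = {b'} \<and> bag b \<subseteq> bag b' \<and> card (bag b') = card (bag b) + 1"

definition forgotten :: "('b \<Rightarrow> nat set) \<Rightarrow> 'b \<Rightarrow> 'b \<Rightarrow> nat" where
  "forgotten bag b b' = the_elem (bag b' - bag b)"

definition nice_tree_decomposition ::
    "nat set \<Rightarrow> nat set set \<Rightarrow> 'b set \<Rightarrow> ('b \<times> 'b) set \<Rightarrow> 'b \<Rightarrow> ('b \<Rightarrow> nat set) \<Rightarrow> bool" where
  "nice_tree_decomposition V G B E r bag \<longleftrightarrow>
     tree_decomposition V G B E r bag \<and>
     bag r = {} \<and>
     (\<forall>b\<in>B. leaf_bag E bag b \<or>
        (\<exists>b1 b2. join_bag E bag b b1 b2) \<or>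
        (\<exists>b'. introduce_bag E bag b b') \<or>
        (\<exists>b'. forget_bag E bag b b'))"


section \<open>The dynamic programming procedure\<close>

text \<open>
  \<open>bfs E q bs\<close>: processing the queue \<open>q\<close> may visit the nodes in the order \<open>bs\<close>. The children
  of a node are enqueued in an arbitrary order.
\<close>

inductive bfs :: "('b \<times> 'b) set \<Rightarrow> 'b list \<Rightarrow> 'b list \<Rightarrow> bool" for E where
  bfs_empty: "bfs E [] []"
| bfs_visit: "distinct cs \<Longrightarrow> set cs = E `` {b} \<Longrightarrow> bfs E (q @ cs) bs \<Longrightarrow> bfs E (b # q) (b # bs)"

text \<open>
  The distribution of the atoms \<open>C\<close> to the bags, which are visited in the order given by the
  list; the remaining atoms are passed on to the next bag. As leaf bags receive nothing, an
  atom whose variables are contained in leaf bags only is never assigned to any bag.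
\<close>

fun distribute ::
    "nat \<Rightarrow> ('b \<times> 'b) set \<Rightarrow> ('b \<Rightarrow> nat set) \<Rightarrow> 'b list \<Rightarrow> atom set \<Rightarrow> 'b \<Rightarrow> atom set" where
  "distribute m E bag [] C = (\<lambda>_. {})"
| "distribute m E bag (b # bs) C =
     (let S = (if leaf_bag E bag b then {} else {\<phi> \<in> C. vars m \<phi> \<subseteq> bag b})
      in (distribute m E bag bs (C - S))(b := S))"

definition dp_values ::
    "'b set \<Rightarrow> ('b \<times> 'b) set \<Rightarrow> ('b \<Rightarrow> nat set) \<Rightarrow> ('b \<Rightarrow> atom set) \<Rightarrow> ('b \<Rightarrow> atom set) \<Rightarrow> bool" where
  "dp_values B E bag I \<V> \<longleftrightarrow> (\<forall>b\<in>B.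
     (leaf_bag E bag b \<longrightarrow> \<V> b = I b) \<and>
     (\<forall>b1 b2. join_bag E bag b b1 b2 \<longrightarrow> \<V> b = I b \<union> \<V> b1 \<union> \<V> b2) \<and>
     (\<forall>b'. introduce_bag E bag b b' \<longrightarrow> \<V> b = I b \<union> \<V> b') \<and>
     (\<forall>b'. forget_bag E bag b b' \<longrightarrow>
        (\<exists>D. FME (\<V> b') (forgotten bag b b') D \<and> \<V> b = I b \<union> D)))"

end

theory Submission
  imports Defs
begin

text \<open>
  Let \<open>X b\<close> be the set of variables that occur in the bags of the subtree of \<open>b\<close> but not in \<open>b\<close>
  itself. By induction from the leaves to the root, \<open>\<V> b\<close> is equivalent to the existential closure
  over \<open>X b\<close> of all atoms assigned to bags in the subtree of \<open>b\<close>. The existential quantifiers can be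
  pushed into the branches of a join because a variable occurring both inside and outside a subtree
  belongs to the bag at its root, by connectedness. At the root, \<open>X r\<close> consists of all quantified
  variables and every atom has been assigned to some bag.
\<close>

section \<open>Correctness of Fourier--Motzkin elimination\<close>

text \<open>Setting \<open>x\<close> to 0 deletes its summand, so every linear expression takes the
  affine form \<open>t + c * v\<close> in the value \<open>v\<close> of \<open>x\<close>. All later
  comparisons involving \<open>x\<close> are read off from this form.\<close>

lemma lin_val_fun_upd:
  assumes "x \<in> {1..n}"
  shows "lin_val n e (\<sigma>(x := v)) = lin_val n e (\<sigma>(x := 0)) + coeff e x * v"
proof -
  have "(\<Sum>i\<in>{1..n}. coeff e i * (\<sigma>(x := w)) i)
      = coeff e x * w + (\<Sum>i\<in>{1..n} - {x}. coeff e i * \<sigma> i)" for w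
    using assms by (simp add: sum.remove[of _ x])
  then show ?thesis
    by (simp add: lin_val_def)
qed

lemma lin_val_isolate:
  assumes "x \<in> {1..n}"
  shows "lin_val n (isolate x e) \<sigma> = - lin_val n e (\<sigma>(x := 0)) / coeff e x"
proof -
  have "(\<Sum>i\<in>{1..n}. coeff (isolate x e) i * \<sigma> i)
      = - (\<Sum>i\<in>{1..n}. coeff e i * (\<sigma>(x := 0)) i) / coeff e x"
    unfolding sum_divide_distrib sum_negf[symmetric]
    by (rule sum.cong) (auto simp: isolate_def)
  then show ?thesis
    by (simp add: lin_val_def isolate_def diff_divide_distrib)
qed

lemma lin_val_subst_lin:
  assumes "x \<in> {1..n}"
  shows "lin_val n (subst_lin x u e) \<sigma> = lin_val n e (\<sigma>(x := lin_val n u \<sigma>))"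
proof -
  have "(\<Sum>i\<in>{1..n}. coeff (subst_lin x u e) i * \<sigma> i)
      = (\<Sum>i\<in>{1..n}. coeff e i * (\<sigma>(x := 0)) i + coeff e x * (coeff u i * \<sigma> i))"
    by (rule sum.cong) (auto simp: subst_lin_def algebra_simps)
  also have "\<dots> = (\<Sum>i\<in>{1..n}. coeff e i * (\<sigma>(x := 0)) i)
      + coeff e x * (\<Sum>i\<in>{1..n}. coeff u i * \<sigma> i)"
    by (simp only: sum.distrib sum_distrib_left)
  finally have "lin_val n (subst_lin x u e) \<sigma>
      = lin_val n e (\<sigma>(x := 0)) + coeff e x * lin_val n u \<sigma>"
    by (simp add: lin_val_def subst_lin_def algebra_simps)
  then show ?thesis
    using lin_val_fun_upd[OF assms, of e \<sigma> "lin_val n u \<sigma>"] by simp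
qed

lemma lin_val_lin_diff: "lin_val n (lin_diff e f) \<sigma> = lin_val n e \<sigma> - lin_val n f \<sigma>"
  by (simp add: lin_val_def lin_diff_def left_diff_distrib sum_subtractf)

lemma lin_val_cong:
  assumes "\<And>i. i \<in> {1..n} \<Longrightarrow> coeff e i \<noteq> 0 \<Longrightarrow> \<sigma> i = \<tau> i"
  shows "lin_val n e \<sigma> = lin_val n e \<tau>"
proof -
  have "(\<Sum>i\<in>{1..n}. coeff e i * \<sigma> i) = (\<Sum>i\<in>{1..n}. coeff e i * \<tau> i)"
    using assms by (intro sum.cong) auto
  then show ?thesis
    by (simp add: lin_val_def)
qed

lemma holds_cong:
  assumes "\<And>i. i \<in> {1..n} \<Longrightarrow> occurs i \<phi> \<Longrightarrow> \<sigma> i = \<tau> i"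
  shows "holds n \<sigma> \<phi> \<longleftrightarrow> holds n \<tau> \<phi>"
  using assms lin_val_cong[of n "lin \<phi>" \<sigma> \<tau>] by (simp add: holds_def occurs_def)

section \<open>Systems of bounds on a single real number\<close>

definition respects_lower :: "real \<times> bool \<Rightarrow> real \<Rightarrow> bool" where
  "respects_lower l v \<longleftrightarrow> (if snd l then fst l < v else fst l \<le> v)"

definition respects_upper :: "real \<times> bool \<Rightarrow> real \<Rightarrow> bool" where
  "respects_upper u v \<longleftrightarrow> (if snd u then v < fst u else v \<le> fst u)"

text \<open>By finiteness, only the largest lower bound and the smallest upper bound restrict
  \<open>v\<close>, and their midpoint is a solution. Strictness cannot be decided from these two
  values alone, because strict and non-strict bounds may share a value; it is recovered by pairing
  each strict bound with an extremal bound of the other side.\<close>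

lemma ex_between_bounds:
  assumes "finite L" "finite U"
  shows "(\<exists>v. (\<forall>l\<in>L. respects_lower l v) \<and> (\<forall>u\<in>U. respects_upper u v)) \<longleftrightarrow>
    (\<forall>l\<in>L. \<forall>u\<in>U. if snd l \<or> snd u then fst l < fst u else fst l \<le> fst u)"
    (is "?ex \<longleftrightarrow> ?pairs")
proof
  show "?ex \<Longrightarrow> ?pairs"
    by (fastforce simp: respects_lower_def respects_upper_def split: if_splits)
next
  assume pairs: ?pairs
  \<comment> \<open>On an empty set \<open>Max\<close> and \<open>Min\<close> are unspecified, but
    then the facts about \<open>lo\<close> or \<open>hi\<close> below range over no element and hold
    vacuously.\<close>
  define lo where "lo = Max (fst ` L)"
  define hi where "hi = Min (fst ` U)"
  have lo: "fst l \<le> lo" if "l \<in> L" for l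
    using that assms by (simp add: lo_def)
  have hi: "hi \<le> fst u" if "u \<in> U" for u
    using that assms by (simp add: hi_def)
  consider "L = {}" | "U = {}" | "L \<noteq> {}" "U \<noteq> {}" by blast
  then show ?ex
  proof cases
    case 1
    \<comment> \<open>Subtracting 1 satisfies strict upper bounds as well; adding 1 in the next case
      serves the same purpose.\<close>
    have "respects_upper u (hi - 1)" if "u \<in> U" for u
      using hi[OF that] by (simp add: respects_upper_def)
    then show ?thesis using 1 by blast
  next
    case 2
    have "respects_lower l (lo + 1)" if "l \<in> L" for l
      using lo[OF that] by (simp add: respects_lower_def)
    then show ?thesis using 2 by blast
  next
    case 3
    have "lo \<in> fst ` L" "hi \<in> fst ` U"
      unfolding lo_def hi_def using 3 assms by (simp_all del: image_iff)
    then obtain l0 u0 where l0: "l0 \<in> L" "fst l0 = lo" and u0: "u0 \<in> U" "fst u0 = hi"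
      by blast
    have "lo \<le> hi"
      using pairs l0 u0 by (metis less_imp_le)
    \<comment> \<open>If \<open>lo = hi\<close>, the midpoint is this common value, and a strict
      \<open>l\<close> is still respected: paired with \<open>u0\<close> it gives
      \<open>fst l < hi\<close>.\<close>
    have "respects_lower l ((lo + hi) / 2)" if "l \<in> L" for l
    proof -
      have "snd l \<Longrightarrow> fst l < hi"
        using pairs that u0 by metis
      then show ?thesis
        using lo[OF that] \<open>lo \<le> hi\<close> by (auto simp: respects_lower_def)
    qed
    moreover have "respects_upper u ((lo + hi) / 2)" if "u \<in> U" for u
    proof -
      have "snd u \<Longrightarrow> lo < fst u"
        using pairs that l0 by metis
      then show ?thesis
        using hi[OF that] \<open>lo \<le> hi\<close> by (auto simp: respects_upper_def)
    qed
    ultimately show ?thesis by blast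
  qed
qed

section \<open>Finiteness and variables of the result of the elimination\<close>

lemma lower_bounds_finite: "finite C \<Longrightarrow> finite (lower_bounds C x)"
  unfolding lower_bounds_def by (rule finite_surj[of C _ "\<lambda>\<phi>. (isolate x (lin \<phi>), strict \<phi>)"]) auto

lemma upper_bounds_finite: "finite C \<Longrightarrow> finite (upper_bounds C x)"
  unfolding upper_bounds_def by (rule finite_surj[of C _ "\<lambda>\<phi>. (isolate x (lin \<phi>), strict \<phi>)"]) auto

lemma FME_finite:
  assumes "finite C" "FME C x D"
  shows "finite D"
proof -
  have "{combine_bounds l u | l u. l \<in> lower_bounds C x \<and> u \<in> upper_bounds C x}
      = (\<lambda>(l, u). combine_bounds l u) ` (lower_bounds C x \<times> upper_bounds C x)"
    by auto
  then show ?thesis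
    using assms by (auto simp: FME_def lower_bounds_finite upper_bounds_finite split: if_splits)
qed

text \<open>Both kinds of elimination build atoms from coefficients of old atoms, with the
  coefficient of \<open>x\<close> set to 0. This is what keeps the values of a forget bag within the
  variables of that bag.\<close>

lemma FME_occurs:
  assumes "FME C x D" "\<phi> \<in> D" "occurs y \<phi>"
  shows "y \<noteq> x" "\<exists>\<psi>\<in>C. occurs y \<psi>"
proof -
  have "y \<noteq> x \<and> (\<exists>\<psi>\<in>C. occurs y \<psi>)"
  proof (cases "\<exists>\<psi>\<in>C. cmp \<psi> = Eq \<and> occurs x \<psi>")
    case True
    then obtain \<psi> \<chi> where "\<psi> \<in> C" "\<chi> \<in> C" "\<phi> = subst_atom x (isolate x (lin \<psi>)) \<chi>"
      using assms by (auto simp: FME_def)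
    then have "y \<noteq> x" "coeff (lin \<chi>) y \<noteq> 0 \<or> coeff (lin \<psi>) y \<noteq> 0"
      using assms(3)
      by (auto simp: subst_atom_def subst_lin_def isolate_def occurs_def split: if_splits)
    then show ?thesis
      using \<open>\<psi> \<in> C\<close> \<open>\<chi> \<in> C\<close> by (auto simp: occurs_def)
  next
    case False
    then consider "\<phi> \<in> C" "\<not> occurs x \<phi>"
      | l u where "l \<in> lower_bounds C x" "u \<in> upper_bounds C x" "\<phi> = combine_bounds l u"
      using assms(1,2) unfolding FME_def by auto
    then show ?thesis
    proof cases
      case 1
      then show ?thesis using assms(3) by auto
    next
      case 2
      then obtain \<psi> \<chi> where "\<psi> \<in> C" "\<chi> \<in> C"
        "fst l = isolate x (lin \<psi>)" "fst u = isolate x (lin \<chi>)"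
        by (auto simp: lower_bounds_def upper_bounds_def)
      then have "y \<noteq> x" "coeff (lin \<psi>) y \<noteq> 0 \<or> coeff (lin \<chi>) y \<noteq> 0"
        using assms(3) 2(3)
        by (auto simp: combine_bounds_def lin_diff_def isolate_def occurs_def split: if_splits)
      then show ?thesis
        using \<open>\<psi> \<in> C\<close> \<open>\<chi> \<in> C\<close> by (auto simp: occurs_def)
    qed
  qed
  then show "y \<noteq> x" "\<exists>\<psi>\<in>C. occurs y \<psi>" by auto
qed

section \<open>Semantics of the elimination\<close>

lemma equality_iff_isolate:
  assumes "x \<in> {1..n}" "cmp \<phi> = Eq" "occurs x \<phi>"
  shows "holds n (\<sigma>(x := v)) \<phi> \<longleftrightarrow> v = lin_val n (isolate x (lin \<phi>)) \<sigma>"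
  using assms lin_val_fun_upd[OF assms(1), of "lin \<phi>" \<sigma> v]
  by (auto simp: holds_def occurs_def lin_val_isolate field_simps)

text \<open>The claim splits atom by atom: in the absence of equalities on \<open>x\<close>, an atom
  either does not mention \<open>x\<close>, or is one lower bound or one upper bound on it.\<close>

lemma holds_iff_bounds:
  assumes x: "x \<in> {1..n}" and no_eq: "\<forall>\<phi>\<in>C. cmp \<phi> = Eq \<longrightarrow> \<not> occurs x \<phi>"
  shows "(\<forall>\<phi>\<in>C. holds n (\<sigma>(x := v)) \<phi>) \<longleftrightarrow>
    (\<forall>\<phi>\<in>C. \<not> occurs x \<phi> \<longrightarrow> holds n \<sigma> \<phi>) \<and>
    (\<forall>l\<in>lower_bounds C x. respects_lower (map_prod (\<lambda>e. lin_val n e \<sigma>) id l) v) \<and>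
    (\<forall>u\<in>upper_bounds C x. respects_upper (map_prod (\<lambda>e. lin_val n e \<sigma>) id u) v)"
    (is "_ \<longleftrightarrow> _ \<and> ?lower \<and> ?upper")
proof -
  define low where "low \<phi> \<longleftrightarrow> coeff (lin \<phi>) x > 0 \<and> cmp \<phi> \<in> {Gt, Ge} \<or>
    coeff (lin \<phi>) x < 0 \<and> cmp \<phi> \<in> {Lt, Le}" for \<phi>
  define up where "up \<phi> \<longleftrightarrow> coeff (lin \<phi>) x > 0 \<and> cmp \<phi> \<in> {Lt, Le} \<or>
    coeff (lin \<phi>) x < 0 \<and> cmp \<phi> \<in> {Gt, Ge}" for \<phi>
  define bound where "bound \<phi> = (lin_val n (isolate x (lin \<phi>)) \<sigma>, strict \<phi>)" for \<phi>
  have "lower_bounds C x = (\<lambda>\<phi>. (isolate x (lin \<phi>), strict \<phi>)) ` {\<phi> \<in> C. low \<phi>}"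
    unfolding lower_bounds_def low_def by blast
  then have lower: "?lower \<longleftrightarrow> (\<forall>\<phi>\<in>C. low \<phi> \<longrightarrow> respects_lower (bound \<phi>) v)"
    by (auto simp: bound_def)
  have "upper_bounds C x = (\<lambda>\<phi>. (isolate x (lin \<phi>), strict \<phi>)) ` {\<phi> \<in> C. up \<phi>}"
    unfolding upper_bounds_def up_def by blast
  then have upper: "?upper \<longleftrightarrow> (\<forall>\<phi>\<in>C. up \<phi> \<longrightarrow> respects_upper (bound \<phi>) v)"
    by (auto simp: bound_def)
  have "holds n (\<sigma>(x := v)) \<phi> \<longleftrightarrow> (\<not> occurs x \<phi> \<longrightarrow> holds n \<sigma> \<phi>) \<and>
      (low \<phi> \<longrightarrow> respects_lower (bound \<phi>) v) \<and> (up \<phi> \<longrightarrow> respects_upper (bound \<phi>) v)" if "\<phi> \<in> C" for \<phi>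
  proof (cases "occurs x \<phi>")
    case False
    then have "holds n (\<sigma>(x := v)) \<phi> \<longleftrightarrow> holds n \<sigma> \<phi>"
      by (intro holds_cong) auto
    with False show ?thesis
      by (auto simp: low_def up_def occurs_def)
  next
    case True
    let ?c = "coeff (lin \<phi>) x" and ?t = "lin_val n (lin \<phi>) (\<sigma>(x := 0))"
    have "holds n (\<sigma>(x := v)) \<phi> \<longleftrightarrow> compare_zero (cmp \<phi>) (?t + ?c * v)"
      by (subst holds_def, subst lin_val_fun_upd[OF x]) simp
    moreover have "fst (bound \<phi>) = - ?t / ?c"
      using lin_val_isolate[OF x] by (auto simp: bound_def)
    moreover have "cmp \<phi> \<noteq> Eq"
      using True no_eq that by auto
    \<comment> \<open>The sign has to be known before dividing by \<open>?c\<close>: a negative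
      coefficient reverses the comparison and so exchanges lower and upper bounds.\<close>
    moreover have "?c > 0 \<or> ?c < 0"
      using True by (auto simp: occurs_def)
    ultimately show ?thesis
      using True
      by (cases "cmp \<phi>")
        (auto simp: low_def up_def respects_lower_def respects_upper_def bound_def strict_def field_simps)
  qed
  then have "(\<forall>\<phi>\<in>C. holds n (\<sigma>(x := v)) \<phi>) \<longleftrightarrow> (\<forall>\<phi>\<in>C. (\<not> occurs x \<phi> \<longrightarrow> holds n \<sigma> \<phi>) \<and>
      (low \<phi> \<longrightarrow> respects_lower (bound \<phi>) v) \<and> (up \<phi> \<longrightarrow> respects_upper (bound \<phi>) v))"
    by (rule ball_cong[OF refl])
  then show ?thesis
    unfolding lower upper by blast
qed

text \<open>If an equality contains \<open>x\<close>, its solution for \<open>x\<close> is the only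
  possible witness \<open>v\<close>, and the quantifier becomes a substitution. Otherwise the atoms
  containing \<open>x\<close> are bounds on \<open>v\<close>, and a common solution exists iff every
  lower bound is compatible with every upper bound.\<close>

theorem FME_correct:
  assumes x: "x \<in> {1..n}" and "finite C" and "FME C x D"
  shows "(\<forall>\<phi>\<in>D. holds n \<sigma> \<phi>) \<longleftrightarrow> (\<exists>v. \<forall>\<phi>\<in>C. holds n (\<sigma>(x := v)) \<phi>)"
proof (cases "\<exists>\<phi>\<in>C. cmp \<phi> = Eq \<and> occurs x \<phi>")
  case True
  then obtain \<psi> where \<psi>: "\<psi> \<in> C" "cmp \<psi> = Eq" "occurs x \<psi>"
    and D: "D = subst_atom x (isolate x (lin \<psi>)) ` (C - {\<psi>})"
    using assms(3) by (auto simp: FME_def)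
  let ?w = "lin_val n (isolate x (lin \<psi>)) \<sigma>"
  have "(\<forall>\<phi>\<in>D. holds n \<sigma> \<phi>) \<longleftrightarrow> (\<forall>\<phi>\<in>C - {\<psi>}. holds n (\<sigma>(x := ?w)) \<phi>)"
    by (simp add: D holds_def subst_atom_def lin_val_subst_lin[OF x])
  moreover have "holds n (\<sigma>(x := v)) \<psi> \<longleftrightarrow> v = ?w" for v
    using equality_iff_isolate[OF x] \<psi> by simp
  ultimately show ?thesis
    using \<psi>(1) by (metis Diff_iff singletonD)
next
  case False
  then have D: "D = {\<phi> \<in> C. \<not> occurs x \<phi>} \<union>
      {combine_bounds l u | l u. l \<in> lower_bounds C x \<and> u \<in> upper_bounds C x}"
    using assms(3) unfolding FME_def by (simp only: if_False)
  let ?val = "map_prod (\<lambda>e. lin_val n e \<sigma>) id"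
  let ?L = "?val ` lower_bounds C x" and ?U = "?val ` upper_bounds C x"
  have "(\<forall>\<phi>\<in>D. holds n \<sigma> \<phi>) \<longleftrightarrow> (\<forall>\<phi>\<in>C. \<not> occurs x \<phi> \<longrightarrow> holds n \<sigma> \<phi>) \<and>
      (\<forall>l\<in>lower_bounds C x. \<forall>u\<in>upper_bounds C x. holds n \<sigma> (combine_bounds l u))"
    unfolding D by blast
  also have "(\<forall>l\<in>lower_bounds C x. \<forall>u\<in>upper_bounds C x. holds n \<sigma> (combine_bounds l u)) \<longleftrightarrow>
      (\<forall>l\<in>?L. \<forall>u\<in>?U. if snd l \<or> snd u then fst l < fst u else fst l \<le> fst u)"
    by (simp add: holds_def combine_bounds_def lin_val_lin_diff)
  also have "\<dots> \<longleftrightarrow> (\<exists>v. (\<forall>l\<in>?L. respects_lower l v) \<and> (\<forall>u\<in>?U. respects_upper u v))"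
    using assms(2)
    by (intro ex_between_bounds[symmetric]) (simp_all add: lower_bounds_finite upper_bounds_finite)
  finally show ?thesis
    using holds_iff_bounds[OF x, of C \<sigma>] False by auto
qed


section \<open>Existential closure over a set of variables\<close>

text \<open>Quantifying over a set in one go leaves the order of elimination open: the tree forgets
  variables in an order of its own, while \<open>exists_block\<close> follows the indices.\<close>

definition satisfiable_over :: "nat \<Rightarrow> nat set \<Rightarrow> atom set \<Rightarrow> (nat \<Rightarrow> real) \<Rightarrow> bool" where
  "satisfiable_over n X A \<sigma> \<longleftrightarrow> (\<exists>\<tau>. (\<forall>i. i \<notin> X \<longrightarrow> \<tau> i = \<sigma> i) \<and> (\<forall>\<phi>\<in>A. holds n \<tau> \<phi>))"

lemma satisfiable_over_empty: "satisfiable_over n {} A \<sigma> \<longleftrightarrow> (\<forall>\<phi>\<in>A. holds n \<sigma> \<phi>)"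
proof -
  have "(\<forall>i. \<tau> i = \<sigma> i) \<longleftrightarrow> \<tau> = \<sigma>" for \<tau>
    by auto
  then show ?thesis
    by (simp add: satisfiable_over_def)
qed

lemma satisfiable_over_insert:
  "satisfiable_over n (insert x X) A \<sigma> \<longleftrightarrow> (\<exists>v. satisfiable_over n X A (\<sigma>(x := v)))"
proof
  assume "satisfiable_over n (insert x X) A \<sigma>"
  then obtain \<tau> where "\<forall>i. i \<notin> insert x X \<longrightarrow> \<tau> i = \<sigma> i" "\<forall>\<phi>\<in>A. holds n \<tau> \<phi>"
    by (auto simp: satisfiable_over_def)
  then have "satisfiable_over n X A (\<sigma>(x := \<tau> x))"
    unfolding satisfiable_over_def by (intro exI[of _ \<tau>]) auto
  then show "\<exists>v. satisfiable_over n X A (\<sigma>(x := v))" ..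
next
  assume "\<exists>v. satisfiable_over n X A (\<sigma>(x := v))"
  then obtain v \<tau> where "\<forall>i. i \<notin> X \<longrightarrow> \<tau> i = (\<sigma>(x := v)) i" "\<forall>\<phi>\<in>A. holds n \<tau> \<phi>"
    by (auto simp: satisfiable_over_def)
  then show "satisfiable_over n (insert x X) A \<sigma>"
    unfolding satisfiable_over_def by (intro exI[of _ \<tau>]) auto
qed

text \<open>Witnesses for the two sides can be glued, since neither set of atoms mentions the
  variables that the other side may change. A variable in both \<open>X\<close> and \<open>Y\<close>
  occurs in no atom at all, so disjointness is not assumed.\<close>

lemma satisfiable_over_Un:
  assumes "\<And>x \<phi>. x \<in> X \<Longrightarrow> \<phi> \<in> B \<Longrightarrow> \<not> occurs x \<phi>"
    and "\<And>y \<phi>. y \<in> Y \<Longrightarrow> \<phi> \<in> A \<Longrightarrow> \<not> occurs y \<phi>"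
  shows "satisfiable_over n (X \<union> Y) (A \<union> B) \<sigma> \<longleftrightarrow>
    satisfiable_over n X A \<sigma> \<and> satisfiable_over n Y B \<sigma>"
proof
  assume "satisfiable_over n (X \<union> Y) (A \<union> B) \<sigma>"
  then obtain \<tau> where \<tau>: "\<forall>i. i \<notin> X \<union> Y \<longrightarrow> \<tau> i = \<sigma> i" "\<forall>\<phi>\<in>A \<union> B. holds n \<tau> \<phi>"
    by (auto simp: satisfiable_over_def)
  have "holds n (\<lambda>i. if i \<in> X then \<tau> i else \<sigma> i) \<phi> \<longleftrightarrow> holds n \<tau> \<phi>" if "\<phi> \<in> A" for \<phi>
    using assms(2)[OF _ that] \<tau>(1) by (intro holds_cong) (metis UnE)
  then have "satisfiable_over n X A \<sigma>"
    unfolding satisfiable_over_def using \<tau>(2)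
    by (intro exI[of _ "\<lambda>i. if i \<in> X then \<tau> i else \<sigma> i"]) auto
  moreover have "holds n (\<lambda>i. if i \<in> Y then \<tau> i else \<sigma> i) \<phi> \<longleftrightarrow> holds n \<tau> \<phi>" if "\<phi> \<in> B" for \<phi>
    using assms(1)[OF _ that] \<tau>(1) by (intro holds_cong) (metis UnE)
  then have "satisfiable_over n Y B \<sigma>"
    unfolding satisfiable_over_def using \<tau>(2)
    by (intro exI[of _ "\<lambda>i. if i \<in> Y then \<tau> i else \<sigma> i"]) auto
  ultimately show "satisfiable_over n X A \<sigma> \<and> satisfiable_over n Y B \<sigma>" ..
next
  assume "satisfiable_over n X A \<sigma> \<and> satisfiable_over n Y B \<sigma>"
  then obtain \<tau> \<upsilon> where \<tau>: "\<forall>i. i \<notin> X \<longrightarrow> \<tau> i = \<sigma> i" "\<forall>\<phi>\<in>A. holds n \<tau> \<phi>"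
    and \<upsilon>: "\<forall>i. i \<notin> Y \<longrightarrow> \<upsilon> i = \<sigma> i" "\<forall>\<phi>\<in>B. holds n \<upsilon> \<phi>"
    by (auto simp: satisfiable_over_def)
  \<comment> \<open>Atoms of \<open>B\<close> avoid \<open>X\<close>, where alone \<rho> may differ
    from \<upsilon>. Atoms of \<open>A\<close> avoid \<open>Y\<close>, and outside \<open>X\<close>
    and \<open>Y\<close> all assignments agree with \<sigma>.\<close>
  define \<rho> where "\<rho> i = (if i \<in> X then \<tau> i else \<upsilon> i)" for i
  have "holds n \<rho> \<phi> \<longleftrightarrow> holds n \<tau> \<phi>" if "\<phi> \<in> A" for \<phi>
    using assms(2)[OF _ that] \<tau>(1) \<upsilon>(1) by (intro holds_cong) (auto simp: \<rho>_def)
  moreover have "holds n \<rho> \<phi> \<longleftrightarrow> holds n \<upsilon> \<phi>" if "\<phi> \<in> B" for \<phi>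
    using assms(1)[OF _ that] by (intro holds_cong) (auto simp: \<rho>_def)
  ultimately show "satisfiable_over n (X \<union> Y) (A \<union> B) \<sigma>"
    unfolding satisfiable_over_def using \<tau> \<upsilon> by (intro exI[of _ \<rho>]) (auto simp: \<rho>_def)
qed

lemma exists_block_iff_satisfiable_over:
  "exists_block m (\<lambda>\<tau>. \<forall>\<phi>\<in>A. holds n \<tau> \<phi>) \<sigma> \<longleftrightarrow> satisfiable_over n {1..m} A \<sigma>"
proof (induction m arbitrary: \<sigma>)
  case 0
  then show ?case by (simp add: satisfiable_over_empty)
next
  case (Suc m)
  then show ?case by (simp add: atLeastAtMostSuc_conv satisfiable_over_insert del: fun_upd_apply)
qed


section \<open>Rooted trees\<close>

text \<open>A cycle through a node also passes through its unique parent. Moving up in this way, it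
  would reach the root, which has no incoming edge.\<close>

lemma rooted_tree_acyclic:
  assumes "rooted_tree B E r"
  shows "acyclic E"
proof -
  have parent: "b = c" if "(b, d) \<in> E" "(c, d) \<in> E" for b c d
    using assms that unfolding rooted_tree_def by blast
  have no_cycle: "(b, b) \<notin> E\<^sup>+" if "(r, b) \<in> E\<^sup>*" for b
    using that
  proof (induction rule: rtrancl_induct)
    case base
    then show ?case
      using assms by (metis rooted_tree_def tranclD2)
  next
    case (step b c)
    then show ?case
      by (metis parent rtrancl_into_trancl2 tranclD2)
  qed
  moreover have "(r, b) \<in> E\<^sup>*" if "(b, b) \<in> E\<^sup>+" for b
    using assms that unfolding rooted_tree_def by (metis SigmaD1 subsetD tranclD)
  ultimately show ?thesis
    by (auto simp: acyclic_def)
qed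

text \<open>In the converse relation children are the smaller elements, so well-founded induction
  runs from the leaves to the root.\<close>

lemma rooted_tree_wf:
  assumes "rooted_tree B E r"
  shows "wf (E\<inverse>)"
proof -
  have "finite E"
    using assms unfolding rooted_tree_def by (meson finite_SigmaI finite_subset)
  then show ?thesis
    using rooted_tree_acyclic[OF assms] by (rule finite_acyclic_wf_converse)
qed

lemma rooted_tree_parent_not_below_child:
  assumes "rooted_tree B E r" "(b, c) \<in> E"
  shows "(c, b) \<notin> E\<^sup>*"
  using rooted_tree_acyclic[OF assms(1)] assms(2)
  by (meson acyclic_def rtrancl_into_trancl2)

text \<open>Induction along the path from \<open>b\<close>: a path from \<open>c\<close> to a node
  on it either enters through the node's unique parent, which is the previous node or
  \<open>a\<close>, or is empty, which makes \<open>a\<close> that previous node. Reaching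
  \<open>a\<close> from one of its children would close a cycle.\<close>

lemma rooted_tree_sibling_subtrees_disjoint:
  assumes tree: "rooted_tree B E r" and bc: "(a, b) \<in> E" "(a, c) \<in> E" "b \<noteq> c"
    and "(b, d) \<in> E\<^sup>*"
  shows "(c, d) \<notin> E\<^sup>*"
proof -
  have parent: "b = c" if "(b, d) \<in> E" "(c, d) \<in> E" for b c d
    using tree that unfolding rooted_tree_def by blast
  show ?thesis
    using \<open>(b, d) \<in> E\<^sup>*\<close>
  proof (induction rule: rtrancl_induct)
    case base
    then show ?case
      using bc parent rooted_tree_parent_not_below_child[OF tree] by (metis rtranclE)
  next
    case (step d e)
    then show ?case
      using bc parent rooted_tree_parent_not_below_child[OF tree] by (metis rtranclE)
  qed
qed

text \<open>A derivation of \<open>bfs\<close> ends with an empty queue, so every enqueued node is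
  eventually visited and its children enqueued.\<close>

lemma bfs_visits_reachable:
  assumes "bfs E q bs" "a \<in> set q" "(a, c) \<in> E\<^sup>*"
  shows "c \<in> set bs"
  using assms
\<comment> \<open>The starting node varies because, once \<open>b\<close> is visited, the rest of
  the path starts at one of its children in the new queue.\<close>
proof (induction arbitrary: a rule: bfs.induct)
  case bfs_empty
  then show ?case by simp
next
  case (bfs_visit cs b q bs)
  show ?case
  proof (cases "a \<in> set q")
    case True
    then show ?thesis using bfs_visit by auto
  next
    case False
    then have "a = b" using bfs_visit.prems by simp
    from bfs_visit.prems(2) show ?thesis
    proof (cases rule: converse_rtranclE)
      case base
      then show ?thesis using \<open>a = b\<close> by simp
    next
      case (step d)
      then show ?thesis using bfs_visit \<open>a = b\<close> by auto
    qed
  qed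
qed

lemma bfs_sound:
  assumes "bfs E q bs" "b \<in> set bs"
  shows "b \<in> E\<^sup>* `` set q"
  using assms
proof (induction rule: bfs.induct)
  case bfs_empty
  then show ?case by simp
next
  case (bfs_visit cs b' q bs)
  then show ?case
    by (auto intro: converse_rtrancl_into_rtrancl)
qed


section \<open>Distribution of the atoms\<close>

lemma distributeD:
  assumes "\<phi> \<in> distribute m E bag bs C b"
  shows "\<phi> \<in> C" "vars m \<phi> \<subseteq> bag b" "\<not> leaf_bag E bag b"
proof -
  have "\<phi> \<in> C \<and> vars m \<phi> \<subseteq> bag b \<and> \<not> leaf_bag E bag b"
    using assms
  proof (induction bs arbitrary: C)
    case Nil
    then show ?case by simp
  next
    case (Cons a bs)
    define S where "S = (if leaf_bag E bag a then {} else {\<phi> \<in> C. vars m \<phi> \<subseteq> bag a})"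
    have "distribute m E bag (a # bs) C = (distribute m E bag bs (C - S))(a := S)"
      by (simp add: S_def Let_def)
    then consider "b = a" "\<phi> \<in> S" | "\<phi> \<in> distribute m E bag bs (C - S) b"
      using Cons.prems by (metis fun_upd_apply)
    then show ?case
    proof cases
      case 1
      then show ?thesis by (simp add: S_def split: if_splits)
    next
      case 2
      then show ?thesis using Cons.IH by blast
    qed
  qed
  then show "\<phi> \<in> C" "vars m \<phi> \<subseteq> bag b" "\<not> leaf_bag E bag b" by auto
qed

text \<open>The atom stays among the remaining ones until the first visited non-leaf bag that
  contains its variables, which is reached at \<open>c\<close> at the latest.\<close>

lemma distribute_complete:
  assumes "\<phi> \<in> C" "c \<in> set bs" "\<not> leaf_bag E bag c" "vars m \<phi> \<subseteq> bag c"
  shows "\<exists>b\<in>set bs. \<phi> \<in> distribute m E bag bs C b"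
  using assms
proof (induction bs arbitrary: C)
  case Nil
  then show ?case by simp
next
  case (Cons b bs)
  define S where "S = (if leaf_bag E bag b then {} else {\<phi> \<in> C. vars m \<phi> \<subseteq> bag b})"
  have eq: "distribute m E bag (b # bs) C = (distribute m E bag bs (C - S))(b := S)"
    by (simp add: S_def Let_def)
  show ?case
  proof (cases "\<phi> \<in> S")
    case True
    then show ?thesis unfolding eq by (intro bexI[of _ b]) simp_all
  next
    case False
    then have "c \<in> set bs"
      using Cons.prems by (auto simp: S_def)
    then obtain d where d: "d \<in> set bs" "\<phi> \<in> distribute m E bag bs (C - S) d"
      using Cons False by blast
    \<comment> \<open>The update at \<open>b\<close> therefore does not overwrite the value at
      \<open>d\<close>.\<close>
    then have "d \<noteq> b"
      using distributeD[OF d(2)] False by (auto simp: S_def)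
    then show ?thesis unfolding eq using d by (intro bexI[of _ d]) simp_all
  qed
qed


section \<open>Correctness of the dynamic programming procedure\<close>

text \<open>Connectedness joins \<open>c\<close> to \<open>d\<close> by a path through nodes whose
  bags contain \<open>v\<close>, and a path out of the subtree of \<open>b\<close> has to visit
  \<open>b\<close>.\<close>

lemma tree_decomposition_crossing:
  assumes td: "tree_decomposition V G B E r bag"
    and c: "c \<in> B" "(b, c) \<in> E\<^sup>*" "v \<in> bag c" and d: "d \<in> B" "(b, d) \<notin> E\<^sup>*" "v \<in> bag d"
  shows "v \<in> bag b"
proof -
  define S where "S = {b \<in> B. v \<in> bag b}"
  have "v \<in> V"
    using td c unfolding tree_decomposition_def by auto
  then have "(c, d) \<in> ((E \<union> E\<inverse>) \<inter> S \<times> S)\<^sup>*"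
    using td c d unfolding tree_decomposition_def by (auto simp: S_def Let_def)
  moreover have parent: "a = a'" if "(a, e) \<in> E" "(a', e) \<in> E" for a a' e
    using td that unfolding tree_decomposition_def rooted_tree_def by blast
  \<comment> \<open>The only edge leaving the subtree of \<open>b\<close> is the one from \<open>b\<close> to its parent.\<close>
  ultimately have "(b, d) \<in> E\<^sup>* \<or> b \<in> S"
  proof (induction rule: rtrancl_induct)
    case base
    then show ?case using c by simp
  next
    case (step y z)
    show ?case
    proof (cases "b \<in> S")
      case False
      then have "(b, y) \<in> E\<^sup>*" "y \<noteq> b" using step by auto
      then obtain p where "(b, p) \<in> E\<^sup>*" "(p, y) \<in> E" by (metis rtranclE)
      then show ?thesis
        using step.hyps(2) \<open>(b, y) \<in> E\<^sup>*\<close> parent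
        by (metis Int_iff UnE converseD rtrancl.rtrancl_into_rtrancl)
    qed simp
  qed
  then show ?thesis using d by (simp add: S_def)
qed

section \<open>The invariant and its propagation through the tree\<close>

definition closed_vars :: "('b \<times> 'b) set \<Rightarrow> ('b \<Rightarrow> nat set) \<Rightarrow> 'b \<Rightarrow> nat set" where
  "closed_vars E bag b = (\<Union>c\<in>E\<^sup>* `` {b}. bag c) - bag b"

definition subtree_atoms :: "('b \<times> 'b) set \<Rightarrow> ('b \<Rightarrow> atom set) \<Rightarrow> 'b \<Rightarrow> atom set" where
  "subtree_atoms E I b = (\<Union>c\<in>E\<^sup>* `` {b}. I c)"

lemma rtrancl_Image_unfold: "E\<^sup>* `` {b} = insert b (\<Union>c\<in>E `` {b}. E\<^sup>* `` {c})"
  by (auto elim: converse_rtranclE intro: converse_rtrancl_into_rtrancl)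

text \<open>Of the traversal, only the finiteness of each \<open>I b\<close> and its fit into the
  bag are kept. Whether all atoms of the formula were assigned matters only when the result at the
  root is compared with the formula.\<close>

locale dp_run =
  fixes m n :: nat and G :: "nat set set" and B :: "'b set" and E r bag
    and I \<V> :: "'b \<Rightarrow> atom set"
  assumes m_le_n: "m \<le> n"
    and nice: "nice_tree_decomposition {1..m} G B E r bag"
    and finite_I: "finite (I b)"
    and vars_I: "\<phi> \<in> I b \<Longrightarrow> vars m \<phi> \<subseteq> bag b"
    and dp: "dp_values B E bag I \<V>"
begin

lemma td: "tree_decomposition {1..m} G B E r bag"
  using nice by (simp add: nice_tree_decomposition_def)

lemma tree: "rooted_tree B E r"
  using td by (simp add: tree_decomposition_def)

lemma bag_subset: "b \<in> B \<Longrightarrow> bag b \<subseteq> {1..m}"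
  using td unfolding tree_decomposition_def by auto

lemma finite_bag: "b \<in> B \<Longrightarrow> finite (bag b)"
  using bag_subset finite_subset by blast

lemma child_in_B: "(b, c) \<in> E \<Longrightarrow> c \<in> B"
  using tree unfolding rooted_tree_def by blast

lemma descendant_in_B:
  assumes "b \<in> B" "(b, c) \<in> E\<^sup>*"
  shows "c \<in> B"
  using assms(2,1) by (induction rule: rtrancl_induct) (auto intro: child_in_B)

lemma closed_vars_subset: "b \<in> B \<Longrightarrow> closed_vars E bag b \<subseteq> {1..m}"
  using bag_subset descendant_in_B unfolding closed_vars_def by blast

lemma occurs_I:
  assumes "\<phi> \<in> I b" "x \<in> {1..m}" "occurs x \<phi>"
  shows "x \<in> bag b"
  using assms vars_I by (auto simp: vars_def)

lemma closed_vars_outside: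
  assumes "b \<in> B" "x \<in> closed_vars E bag b" "d \<in> B" "(b, d) \<notin> E\<^sup>*"
  shows "x \<notin> bag d"
  using assms tree_decomposition_crossing[OF td, of _ b x d] descendant_in_B
  unfolding closed_vars_def by blast

lemma closed_vars_not_occurs_outside:
  assumes "b \<in> B" "x \<in> closed_vars E bag b" "d \<in> B" "(b, d) \<notin> E\<^sup>*" "\<phi> \<in> I d"
  shows "\<not> occurs x \<phi>"
  using assms closed_vars_outside closed_vars_subset occurs_I by blast

text \<open>The induction invariant. Finiteness is required by \<open>FME_correct\<close>; the
  inclusion in the bag shows at the root, whose bag is empty, that no quantified variable is
  left.\<close>

definition correct_at :: "'b \<Rightarrow> bool" where
  "correct_at b \<longleftrightarrow> finite (\<V> b) \<and> (\<forall>\<phi>\<in>\<V> b. vars m \<phi> \<subseteq> bag b) \<and>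
     (\<forall>\<sigma>. (\<forall>\<phi>\<in>\<V> b. holds n \<sigma> \<phi>) \<longleftrightarrow>
       satisfiable_over n (closed_vars E bag b) (subtree_atoms E I b) \<sigma>)"

text \<open>Among the quantified variables, atoms of \<open>I b\<close> mention only those in
  \<open>bag b\<close>, so they can be moved out of the scope of quantifiers over variables outside
  the bag.\<close>

lemma satisfiable_over_add_I:
  assumes "b \<in> B" "X \<subseteq> {1..m}" "X \<inter> bag b = {}"
  shows "satisfiable_over n X (I b \<union> A) \<sigma> \<longleftrightarrow>
    (\<forall>\<phi>\<in>I b. holds n \<sigma> \<phi>) \<and> satisfiable_over n X A \<sigma>"
proof -
  have "satisfiable_over n ({} \<union> X) (I b \<union> A) \<sigma> \<longleftrightarrow>
      satisfiable_over n {} (I b) \<sigma> \<and> satisfiable_over n X A \<sigma>"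
    using assms occurs_I by (intro satisfiable_over_Un) blast+
  then show ?thesis
    by (simp add: satisfiable_over_empty)
qed

lemma correct_at_leaf:
  assumes "b \<in> B" "leaf_bag E bag b"
  shows "correct_at b"
proof -
  have "\<V> b = I b"
    using assms dp unfolding dp_values_def by blast
  moreover have "E\<^sup>* `` {b} = {b}"
    using assms(2) by (subst rtrancl_Image_unfold) (simp add: leaf_bag_def)
  then have "closed_vars E bag b = {}" "subtree_atoms E I b = I b"
    unfolding closed_vars_def subtree_atoms_def by simp_all
  ultimately show ?thesis
    using finite_I vars_I by (simp add: correct_at_def satisfiable_over_empty)
qed

lemma correct_at_join:
  assumes b: "b \<in> B" and join: "join_bag E bag b b1 b2"
    and correct: "correct_at b1" "correct_at b2"
  shows "correct_at b"
proof -
  have children: "E `` {b} = {b1, b2}" "b1 \<noteq> b2" and bags: "bag b1 = bag b" "bag b2 = bag b"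
    using join by (auto simp: join_bag_def)
  have edges: "(b, b1) \<in> E" "(b, b2) \<in> E"
    using children by auto
  then have in_B: "b1 \<in> B" "b2 \<in> B"
    using child_in_B by auto
  have \<V>: "\<V> b = I b \<union> \<V> b1 \<union> \<V> b2"
    using b join dp unfolding dp_values_def by blast
  let ?X = "closed_vars E bag" and ?A = "subtree_atoms E I"
  have X: "?X b = ?X b1 \<union> ?X b2"
    unfolding closed_vars_def bags
    by (subst rtrancl_Image_unfold) (auto simp: children(1) bags)
  have A: "?A b = I b \<union> (?A b1 \<union> ?A b2)"
    unfolding subtree_atoms_def by (subst rtrancl_Image_unfold) (auto simp: children(1))
  have "satisfiable_over n (?X b) (?A b) \<sigma> \<longleftrightarrow> (\<forall>\<phi>\<in>I b. holds n \<sigma> \<phi>) \<and>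
      satisfiable_over n (?X b1 \<union> ?X b2) (?A b1 \<union> ?A b2) \<sigma>" for \<sigma>
    unfolding A X[symmetric] using b closed_vars_subset
    by (intro satisfiable_over_add_I) (auto simp: closed_vars_def)
  moreover have "satisfiable_over n (?X b1 \<union> ?X b2) (?A b1 \<union> ?A b2) \<sigma> \<longleftrightarrow>
      satisfiable_over n (?X b1) (?A b1) \<sigma> \<and> satisfiable_over n (?X b2) (?A b2) \<sigma>" for \<sigma>
  \<comment> \<open>Each atom below one child is assigned to a node outside the subtree of the other
    child, where no variable closed in that other subtree can occur.\<close>
  proof (rule satisfiable_over_Un)
    fix x \<phi> assume "x \<in> ?X b1" "\<phi> \<in> ?A b2"
    then show "\<not> occurs x \<phi>"
      using rooted_tree_sibling_subtrees_disjoint[OF tree edges(2,1) children(2)[symmetric]]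
        closed_vars_not_occurs_outside[OF in_B(1)] descendant_in_B[OF in_B(2)]
      unfolding subtree_atoms_def by blast
  next
    fix x \<phi> assume "x \<in> ?X b2" "\<phi> \<in> ?A b1"
    then show "\<not> occurs x \<phi>"
      using rooted_tree_sibling_subtrees_disjoint[OF tree edges children(2)]
        closed_vars_not_occurs_outside[OF in_B(2)] descendant_in_B[OF in_B(1)]
      unfolding subtree_atoms_def by blast
  qed
  moreover have "vars m \<phi> \<subseteq> bag b" if "\<phi> \<in> \<V> b" for \<phi>
    using that correct vars_I bags unfolding correct_at_def \<V> by blast
  ultimately show ?thesis
    using correct finite_I unfolding correct_at_def by (simp add: \<V> ball_Un)
qed

lemma correct_at_introduce:
  assumes b: "b \<in> B" and intro: "introduce_bag E bag b b'" and correct: "correct_at b'"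
  shows "correct_at b"
proof -
  have child: "E `` {b} = {b'}" and bags: "bag b' \<subseteq> bag b"
    using intro by (auto simp: introduce_bag_def)
  have edge: "(b, b') \<in> E"
    using child by auto
  then have in_B: "b' \<in> B"
    using child_in_B by auto
  have \<V>: "\<V> b = I b \<union> \<V> b'"
    using b intro dp unfolding dp_values_def by blast
  let ?X = "closed_vars E bag" and ?A = "subtree_atoms E I"
  \<comment> \<open>The parent \<open>b\<close> lies outside the subtree of \<open>b'\<close>, so a
    variable closed at \<open>b'\<close> cannot reappear in \<open>bag b\<close>. Hence an introduce
    bag leaves the set of closed variables unchanged.\<close>
  have disjoint: "?X b' \<inter> bag b = {}"
    using closed_vars_outside[OF in_B _ b rooted_tree_parent_not_below_child[OF tree edge]] by blast
  have "?X b = (\<Union>c\<in>E\<^sup>* `` {b'}. bag c) - bag b"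
    unfolding closed_vars_def by (subst rtrancl_Image_unfold) (auto simp: child)
  also have "\<dots> = ?X b'"
    using disjoint bags unfolding closed_vars_def by blast
  finally have X: "?X b = ?X b'" .
  have A: "?A b = I b \<union> ?A b'"
    unfolding subtree_atoms_def by (subst rtrancl_Image_unfold) (auto simp: child)
  have "satisfiable_over n (?X b) (?A b) \<sigma> \<longleftrightarrow> (\<forall>\<phi>\<in>I b. holds n \<sigma> \<phi>) \<and>
      satisfiable_over n (?X b') (?A b') \<sigma>" for \<sigma>
    unfolding A X using b in_B disjoint closed_vars_subset
    by (intro satisfiable_over_add_I) auto
  moreover have "vars m \<phi> \<subseteq> bag b" if "\<phi> \<in> \<V> b" for \<phi>
    using that correct vars_I bags unfolding correct_at_def \<V> by blast
  ultimately show ?thesis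
    using correct finite_I unfolding correct_at_def by (simp add: \<V> ball_Un)
qed

lemma correct_at_forget:
  assumes b: "b \<in> B" and forget: "forget_bag E bag b b'" and correct: "correct_at b'"
  shows "correct_at b"
proof -
  have child: "E `` {b} = {b'}" and bags: "bag b \<subseteq> bag b'"
    and card: "card (bag b') = card (bag b) + 1"
    using forget by (auto simp: forget_bag_def)
  have in_B: "b' \<in> B"
    using child child_in_B by auto
  define x where "x = forgotten bag b b'"
  \<comment> \<open>\<open>forgotten\<close> is defined by \<open>the_elem\<close>, which is
    meaningful only on a singleton.\<close>
  have "card (bag b' - bag b) = 1"
    using card bags finite_bag[OF b] by (simp add: card_Diff_subset)
  then obtain y where "bag b' - bag b = {y}"
    by (rule card_1_singletonE)
  then have diff: "bag b' - bag b = {x}"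
    by (simp only: x_def forgotten_def the_elem_eq)
  then have "x \<in> {1..m}"
    using bag_subset[OF in_B] by blast
  \<comment> \<open>Coefficients beyond \<open>n\<close> are ignored by \<open>lin_val\<close>, so
    the elimination is justified only for an index in this range.\<close>
  then have x: "x \<in> {1..n}"
    using m_le_n by simp
  obtain D where D: "FME (\<V> b') x D" and \<V>: "\<V> b = I b \<union> D"
    using b forget dp unfolding dp_values_def x_def by blast
  let ?X = "closed_vars E bag" and ?A = "subtree_atoms E I"
  have "?X b = (\<Union>c\<in>E\<^sup>* `` {b'}. bag c) - bag b"
    unfolding closed_vars_def by (subst rtrancl_Image_unfold) (auto simp: child)
  also have "\<dots> = insert x (?X b')"
    using diff bags unfolding closed_vars_def by blast
  finally have X: "?X b = insert x (?X b')" .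
  have A: "?A b = I b \<union> ?A b'"
    unfolding subtree_atoms_def by (subst rtrancl_Image_unfold) (auto simp: child)
  have "satisfiable_over n (?X b) (?A b) \<sigma> \<longleftrightarrow> (\<forall>\<phi>\<in>I b. holds n \<sigma> \<phi>) \<and>
      satisfiable_over n (?X b) (?A b') \<sigma>" for \<sigma>
    unfolding A using b closed_vars_subset
    by (intro satisfiable_over_add_I) (auto simp: closed_vars_def)
  \<comment> \<open>The forgotten variable is quantified outermost; the induction hypothesis,
    applied under each assignment \<open>\<sigma>(x := v)\<close>, turns the inner part into
    \<open>\<V> b'\<close>.\<close>
  moreover have "satisfiable_over n (?X b) (?A b') \<sigma> \<longleftrightarrow> (\<forall>\<phi>\<in>D. holds n \<sigma> \<phi>)" for \<sigma>
    using FME_correct[OF x _ D] correct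
    by (simp add: X satisfiable_over_insert correct_at_def)
  moreover have vars_D: "vars m \<phi> \<subseteq> bag b" if "\<phi> \<in> D" for \<phi>
  proof
    fix z assume "z \<in> vars m \<phi>"
    then have "z \<noteq> x" "\<exists>\<psi>\<in>\<V> b'. z \<in> vars m \<psi>"
      using FME_occurs[OF D that, of z] unfolding vars_def by blast+
    then show "z \<in> bag b"
      using correct diff unfolding correct_at_def by blast
  qed
  moreover have "finite D"
    using FME_finite[OF _ D] correct by (simp add: correct_at_def)
  moreover have "vars m \<phi> \<subseteq> bag b" if "\<phi> \<in> \<V> b" for \<phi>
    using that vars_I vars_D unfolding \<V> by blast
  ultimately show ?thesis
    using finite_I unfolding correct_at_def by (simp add: \<V> ball_Un)
qed

lemma correct_at_all:
  assumes "b \<in> B"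
  shows "correct_at b"
  using rooted_tree_wf[OF tree] assms
proof (induction b rule: wf_induct_rule)
  case (less b)
  have IH: "correct_at c" if "c \<in> E `` {b}" for c
    using less.IH that child_in_B by auto
  have "leaf_bag E bag b \<or> (\<exists>b1 b2. join_bag E bag b b1 b2) \<or>
      (\<exists>b'. introduce_bag E bag b b') \<or> (\<exists>b'. forget_bag E bag b b')"
    using nice less.prems by (auto simp: nice_tree_decomposition_def)
  then show ?case
  proof (elim disjE exE)
    assume "leaf_bag E bag b"
    then show ?thesis using correct_at_leaf less.prems by simp
  next
    fix b1 b2 assume join: "join_bag E bag b b1 b2"
    then have "correct_at b1" "correct_at b2"
      by (auto intro!: IH simp: join_bag_def)
    then show ?thesis using correct_at_join join less.prems by simp
  next
    fix b' assume intro: "introduce_bag E bag b b'"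
    then have "correct_at b'"
      by (auto intro!: IH simp: introduce_bag_def)
    then show ?thesis using correct_at_introduce intro less.prems by simp
  next
    fix b' assume forget: "forget_bag E bag b b'"
    then have "correct_at b'"
      by (auto intro!: IH simp: forget_bag_def)
    then show ?thesis using correct_at_forget forget less.prems by simp
  qed
qed

lemma correct_at_root:
  shows "finite (\<V> r)" "\<forall>\<phi>\<in>\<V> r. vars m \<phi> = {}"
    "(\<forall>\<phi>\<in>\<V> r. holds n \<sigma> \<phi>) \<longleftrightarrow> satisfiable_over n {1..m} (\<Union>b\<in>B. I b) \<sigma>"
proof -
  have r: "r \<in> B" "bag r = {}"
    using tree nice by (simp_all add: rooted_tree_def nice_tree_decomposition_def)
  have "E\<^sup>* `` {r} = B"
    using tree descendant_in_B[OF r(1)] by (auto simp: rooted_tree_def)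
  then have "closed_vars E bag r = {1..m}" "subtree_atoms E I r = (\<Union>b\<in>B. I b)"
    using td r(2) by (simp_all add: closed_vars_def subtree_atoms_def tree_decomposition_def)
  then show "finite (\<V> r)" "\<forall>\<phi>\<in>\<V> r. vars m \<phi> = {}"
    "(\<forall>\<phi>\<in>\<V> r. holds n \<sigma> \<phi>) \<longleftrightarrow> satisfiable_over n {1..m} (\<Union>b\<in>B. I b) \<sigma>"
    using correct_at_all[OF r(1)] r(2) by (auto simp: correct_at_def)
qed

end

text \<open>Leaf bags receive no atoms, so an atom whose variables fit into leaf bags only would be
  lost; \<open>no_atom_dropped\<close> excludes this. Without it, take m = 1, a root with an empty
  bag above a single leaf with bag {1}, and the atoms x1 < 0 and x1 > 0: neither is assigned, and
  the empty conjunction is returned for an unsatisfiable formula.\<close>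

theorem theorem1:
  fixes m n :: nat
    and \<Phi> :: "atom list"
    and B :: "'b set" and E :: "('b \<times> 'b) set" and r :: 'b
    and bag :: "'b \<Rightarrow> nat set"
    and order :: "'b list"
    and I \<V> :: "'b \<Rightarrow> atom set"
  assumes "m \<le> n"
    and "nice_tree_decomposition {1..m} (primal_edges m (set \<Phi>)) B E r bag"
    and "bfs E [r] order"
    and "I = distribute m E bag order (set \<Phi>)"
    and "dp_values B E bag I \<V>"
    and no_atom_dropped: "\<forall>\<phi>\<in>set \<Phi>. \<exists>b\<in>B. \<not> leaf_bag E bag b \<and> vars m \<phi> \<subseteq> bag b"
  shows "finite (\<V> r) \<and> (\<forall>\<phi>\<in>\<V> r. vars m \<phi> = {}) \<and>
    (\<forall>\<sigma> :: nat \<Rightarrow> real.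
       (\<forall>\<phi>\<in>\<V> r. holds n \<sigma> \<phi>) \<longleftrightarrow> exists_block m (\<lambda>\<tau>. \<forall>\<phi>\<in>set \<Phi>. holds n \<tau> \<phi>) \<sigma>)"
proof -
  have I_subset: "I b \<subseteq> set \<Phi>" for b
    unfolding assms(4) using distributeD(1) by fast
  interpret dp_run m n "primal_edges m (set \<Phi>)" B E r bag I \<V>
  proof
    show "m \<le> n" "nice_tree_decomposition {1..m} (primal_edges m (set \<Phi>)) B E r bag"
      "dp_values B E bag I \<V>"
      using assms(1,2,5) .
    show "finite (I b)" for b
      using I_subset by (rule finite_subset) simp
    show "vars m \<phi> \<subseteq> bag b" if "\<phi> \<in> I b" for \<phi> b
      using that distributeD(2) unfolding assms(4) by fast
  qed
  have order: "set order = B"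
  proof
    show "set order \<subseteq> B"
      using bfs_sound[OF assms(3)] descendant_in_B tree by (auto simp: rooted_tree_def)
    show "B \<subseteq> set order"
      using bfs_visits_reachable[OF assms(3)] tree by (auto simp: rooted_tree_def)
  qed
  have "(\<Union>b\<in>B. I b) = set \<Phi>"
  proof
    show "(\<Union>b\<in>B. I b) \<subseteq> set \<Phi>"
      using I_subset by blast
    show "set \<Phi> \<subseteq> (\<Union>b\<in>B. I b)"
    proof
      fix \<phi> assume \<phi>: "\<phi> \<in> set \<Phi>"
      then obtain c where c: "c \<in> set order" "\<not> leaf_bag E bag c" "vars m \<phi> \<subseteq> bag c"
        using no_atom_dropped order by metis
      have "\<exists>b\<in>set order. \<phi> \<in> I b"
        unfolding assms(4) using \<phi> c by (rule distribute_complete)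
      then show "\<phi> \<in> (\<Union>b\<in>B. I b)"
        by (simp add: order)
    qed
  qed
  then show ?thesis
    using correct_at_root unfolding exists_block_iff_satisfiable_over by metis
qed

end
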